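(* Let $U : \mathbb{R}^{n_x} \times \mathbb{R}^{n_\theta} \to \mathbb{R}^{n_U}$ be an artificial neural network with $J$ layers and weights $\theta \in \mathbb{R}^{n_\theta}$. Let $\Xi_l := \theta\in\mathbb{R}^{n_\theta\times 1}$, let $\Xi_{ll}\in\mathbb{R}^{n_\theta\times J}$ be the matrix with entries $\Xi_{ll,i,j}=\theta_i$ if $\theta_i$ belongs to layer $j$ and $\Xi_{ll,i,j}=0$ otherwise ($i\in\{1,\dots,n_\theta\}$, $j\in\{1,\dots,J\}$), and let $\mathbf{1}_J$ be the all-ones vector of dimension $J$. Let $G_c$, $G_l$, $G_{ll}$ be the sensitivities of the differential states of the universal differential equation with respect to $\theta$, to the scalar parameter $p_l$ scaling all weights, and to the vector $p_{ll}$ scaling the weights layerwise, respectively (as defined in the context). Then for almost every $t \in \mathcal{T}=[0,t_{\mathrm f}]$ $$G_l(t) = G_c(t) \, \Xi_l, \qquad G_{ll}(t) = G_c(t) \, \Xi_{ll}, \qquad G_{l}(t) = G_{ll}(t) \, \mathbf{1}_{J}.$$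
   Context: Universal differential equation (UDE): $\dot x(t)=f(x(t),u(t),p)$ on $\mathcal{T}=[0,t_{\mathrm f}]$, $x(0)=x_0(\hat p)$, with $p=(\hat p,\theta)$, $\hat p\in\mathbb{R}^{n_{\hat p}}$, $\theta\in\mathbb{R}^{n_\theta}$, and $$f(x,u,p)=f_S\big(\hat f(x,u,\hat p),\,U(x,\theta)\big),$$ where $\hat f:\mathbb{R}^{n_x}\times\mathbb{R}^{n_u}\times\mathbb{R}^{n_{\hat p}}\to\mathbb{R}^{n_{\hat f}}$, $f_S:\mathbb{R}^{n_{\hat f}}\times\mathbb{R}^{n_U}\to\mathbb{R}^{n_x}$, and all functions are sufficiently smooth. The network $U(x,\theta)=x^{(J)}$ is given by $x^{(0)}=x$, $x^{(j)}=s^{(j)}(W_jx^{(j-1)}+b_j)$ for $j=1,\dots,J$, with activation functions $s^{(j)}$ applied elementwise; $\theta^{(j)}$ is the vector of all entries of $W_j$ and $b_j$ (the weights belonging to layer $j$), and $\theta$ collects $\theta^{(1)},\dots,\theta^{(J)}$, so every $\theta_i$ belongs to exactly one layer. The control $u$, the parameters and the solution $x$ are fixed; the variational equations below are assumed well-posed (unique solutions on $\mathcal T$). Sensitivities: write $f_x=\frac{\partial f_S}{\partial \hat f}\frac{\partial\hat f}{\partial x}+\frac{\partial f_S}{\partial U}\frac{\partial U}{\partial x}$, evaluated along $(x(t),u(t),p)$. - $G_c:\mathcal T\to\mathbb{R}^{n_x\times n_\theta}$ (sensitivity $\mathrm{d}x/\mathrm{d}\theta$) solves $\dot G_c=f_xG_c+\frac{\partial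 f_S}{\partial U}\frac{\partial U}{\partial\theta}(x(t),\theta)$, $G_c(0)=0$. - Lumping of all weights: replace $\theta$ in $U$ by $\theta_l=\theta\cdot p_l=\Xi_l\,p_l$ with a scalar parameter $p_l$ whose nominal value is $1$. $G_l:\mathcal T\to\mathbb{R}^{n_x\times1}$ (sensitivity $\mathrm{d}x/\mathrm{d}p_l$ at $p_l=1$) solves $\dot G_l=f_xG_l+\frac{\partial f_S}{\partial U}\,\frac{\partial}{\partial p_l}U(x(t),\Xi_l p_l)\big|_{p_l=1}$, $G_l(0)=0$. - Layerwise lumping: replace $\theta$ in $U$ by $\theta_{ll}=\Xi_{ll}\,p_{ll}$ with a parameter vector $p_{ll}\in\mathbb{R}^J$ whose nominal value is $(1,\dots,1)$. $G_{ll}:\mathcal T\to\mathbb{R}^{n_x\times J}$ (sensitivity $\mathrm{d}x/\mathrm{d}p_{ll}$ at $p_{ll}=(1,\dots,1)$) solves $\dot G_{ll}=f_xG_{ll}+\frac{\partial f_S}{\partial U}\,\frac{\partial}{\partial p_{ll}}U(x(t),\Xi_{ll}p_{ll})\big|_{p_{ll}=(1,\dots,1)}$, $G_{ll}(0)=0$. *)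

theory Defs
  imports "HOL-Analysis.Analysis"
begin

definition C1 :: "('a::real_normed_vector \<Rightarrow> 'b::real_normed_vector) \<Rightarrow> bool" where
  "C1 f \<longleftrightarrow> (\<exists>f'. (\<forall>x. (f has_derivative blinfun_apply (f' x)) (at x)) \<and> continuous_on UNIV f')"

text \<open>
  The network has \<open>CARD('j)\<close> layers; \<open>width N k\<close> is the number of units of layer \<open>k\<close>, where
  layer \<open>0\<close> is the input. Units are numbered from \<open>0\<close>. Since widths vary with the layer while
  input, output, weight vector and lumped parameters live in Cartesian spaces over index types,
  the record also fixes arbitrary numberings that connect the two.
\<close>

datatype weight_pos =
    Weight nat nat nat  \<comment> \<open>layer, row, column of the entry of \<open>W\<^sub>j\<close>\<close>
  | Bias nat nat        \<comment> \<open>layer, row of the entry of \<open>b\<^sub>j\<close>\<close>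

record ('x, 'o, 'w, 'j) ann =
  width :: "nat \<Rightarrow> nat"
  activation :: "nat \<Rightarrow> real \<Rightarrow> real"
  input_coord :: "nat \<Rightarrow> 'x"
  output_unit :: "'o \<Rightarrow> nat"
  weight_coord :: "weight_pos \<Rightarrow> 'w"
  layer_number :: "'j \<Rightarrow> nat"

definition layer_positions :: "('x, 'o, 'w, 'j) ann \<Rightarrow> nat \<Rightarrow> weight_pos set" where
  "layer_positions N k =
     {Weight k r c | r c. r < width N k \<and> c < width N (k - 1)} \<union> {Bias k r | r. r < width N k}"

definition is_ann :: "('x::finite, 'o::finite, 'w::finite, 'j::finite) ann \<Rightarrow> bool" where
  "is_ann N \<longleftrightarrow>
     bij_betw (input_coord N) {..<width N 0} UNIV \<and>
     bij_betw (output_unit N) UNIV {..<width N CARD('j)} \<and>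
     bij_betw (layer_number N) UNIV {1..CARD('j)} \<and>
     bij_betw (weight_coord N) (\<Union>k\<in>{1..CARD('j)}. layer_positions N k) UNIV"

text \<open>\<open>layer_out N x \<theta> k r\<close> is component \<open>r\<close> of the vector computed by layer \<open>k\<close>.\<close>

primrec layer_out ::
  "('x::finite, 'o, 'w::finite, 'j) ann \<Rightarrow> real^'x \<Rightarrow> real^'w \<Rightarrow> nat \<Rightarrow> nat \<Rightarrow> real" where
  "layer_out N x \<theta> 0 = (\<lambda>r. x $ input_coord N r)"
| "layer_out N x \<theta> (Suc k) = (\<lambda>r. activation N (Suc k)
     ((\<Sum>c<width N k. \<theta> $ weight_coord N (Weight (Suc k) r c) * layer_out N x \<theta> k c)
        + \<theta> $ weight_coord N (Bias (Suc k) r)))"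

definition ann_fun ::
  "('x::finite, 'o::finite, 'w::finite, 'j::finite) ann \<Rightarrow> real^'x \<Rightarrow> real^'w \<Rightarrow> real^'o" where
  "ann_fun N x \<theta> = (\<chi> i. layer_out N x \<theta> CARD('j) (output_unit N i))"

definition belongs_to_layer :: "('x, 'o, 'w, 'j) ann \<Rightarrow> 'w \<Rightarrow> 'j \<Rightarrow> bool" where
  "belongs_to_layer N i j \<longleftrightarrow> i \<in> weight_coord N ` layer_positions N (layer_number N j)"

definition Xi_l :: "real^'w \<Rightarrow> real^1^'w" where
  "Xi_l \<theta> = columnvector \<theta>"

definition Xi_ll :: "('x, 'o, 'w, 'j) ann \<Rightarrow> real^'w \<Rightarrow> real^'j^'w" where
  "Xi_ll N \<theta> = (\<chi> i j. if belongs_to_layer N i j then \<theta> $ i else 0)"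

definition ones :: "real^'n" where
  "ones = (\<chi> i. 1)"

definition absolutely_continuous_on_interval ::
  "real \<Rightarrow> real \<Rightarrow> (real \<Rightarrow> 'a::metric_space) \<Rightarrow> bool" where
  "absolutely_continuous_on_interval a b g \<longleftrightarrow>
     (\<forall>e>0. \<exists>d>0. \<forall>I :: (real \<times> real) set.
        finite I \<and> (\<forall>(l, r)\<in>I. a \<le> l \<and> l \<le> r \<and> r \<le> b) \<and>
        pairwise (\<lambda>(l, r) (l', r'). {l<..<r} \<inter> {l'<..<r'} = {}) I \<and>
        (\<Sum>(l, r)\<in>I. r - l) < d
        \<longrightarrow> (\<Sum>(l, r)\<in>I. dist (g l) (g r)) < e)"

text \<open>
  Solutions are understood in the sense of Caratheodory, since the control enters the right-hand
  side and need not be continuous; for continuous right-hand sides these are the classical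
  solutions.
\<close>

definition solves_ivp ::
  "real \<Rightarrow> (real \<Rightarrow> 'a \<Rightarrow> 'a) \<Rightarrow> 'a \<Rightarrow> (real \<Rightarrow> 'a::real_normed_vector) \<Rightarrow> bool" where
  "solves_ivp tf F y0 y \<longleftrightarrow>
     absolutely_continuous_on_interval 0 tf y \<and>
     (AE t in lebesgue_on {0..tf}. (y has_vector_derivative F t (y t)) (at t within {0..tf})) \<and>
     y 0 = y0"

definition well_posed_ivp ::
  "real \<Rightarrow> (real \<Rightarrow> 'a \<Rightarrow> 'a) \<Rightarrow> 'a::real_normed_vector \<Rightarrow> bool" where
  "well_posed_ivp tf F y0 \<longleftrightarrow>
     (\<exists>y. solves_ivp tf F y0 y) \<and>
     (\<forall>y z. solves_ivp tf F y0 y \<and> solves_ivp tf F y0 z \<longrightarrow> (\<forall>t\<in>{0..tf}. y t = z t))"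

text \<open>
  Throughout, \<open>U\<close> stands for the network as a function of input and weights, \<open>\<xi>\<close>, \<open>\<upsilon>\<close> for the
  current values of state and control, and \<open>q\<close> for the parameters of the known part.
\<close>

definition ude_rhs ::
  "(real^'f \<Rightarrow> real^'o \<Rightarrow> real^'x) \<Rightarrow> (real^'x \<Rightarrow> real^'u \<Rightarrow> real^'q \<Rightarrow> real^'f) \<Rightarrow>
   (real^'x \<Rightarrow> real^'w \<Rightarrow> real^'o) \<Rightarrow> real^'q \<Rightarrow> real^'w \<Rightarrow> real^'x \<Rightarrow> real^'u \<Rightarrow> real^'x" where
  "ude_rhs fS fh U q \<theta> \<xi> \<upsilon> = fS (fh \<xi> \<upsilon> q) (U \<xi> \<theta>)"

definition dfS_dfh ::
  "(real^'f \<Rightarrow> real^'o \<Rightarrow> real^'x) \<Rightarrow> (real^'x \<Rightarrow> real^'u \<Rightarrow> real^'q \<Rightarrow> real^'f) \<Rightarrow>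
   (real^'x \<Rightarrow> real^'w \<Rightarrow> real^'o) \<Rightarrow> real^'q \<Rightarrow> real^'w \<Rightarrow> real^'x \<Rightarrow> real^'u \<Rightarrow> real^'f^'x" where
  "dfS_dfh fS fh U q \<theta> \<xi> \<upsilon> = jacobian (\<lambda>z. fS z (U \<xi> \<theta>)) (at (fh \<xi> \<upsilon> q))"

definition dfS_dU ::
  "(real^'f \<Rightarrow> real^'o \<Rightarrow> real^'x) \<Rightarrow> (real^'x \<Rightarrow> real^'u \<Rightarrow> real^'q \<Rightarrow> real^'f) \<Rightarrow>
   (real^'x \<Rightarrow> real^'w \<Rightarrow> real^'o) \<Rightarrow> real^'q \<Rightarrow> real^'w \<Rightarrow> real^'x \<Rightarrow> real^'u \<Rightarrow> real^'o^'x" where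
  "dfS_dU fS fh U q \<theta> \<xi> \<upsilon> = jacobian (\<lambda>v. fS (fh \<xi> \<upsilon> q) v) (at (U \<xi> \<theta>))"

definition df_dx ::
  "(real^'f \<Rightarrow> real^'o \<Rightarrow> real^'x) \<Rightarrow> (real^'x \<Rightarrow> real^'u \<Rightarrow> real^'q \<Rightarrow> real^'f) \<Rightarrow>
   (real^'x \<Rightarrow> real^'w \<Rightarrow> real^'o) \<Rightarrow> real^'q \<Rightarrow> real^'w \<Rightarrow> real^'x \<Rightarrow> real^'u \<Rightarrow> real^'x^'x" where
  "df_dx fS fh U q \<theta> \<xi> \<upsilon> =
     dfS_dfh fS fh U q \<theta> \<xi> \<upsilon> ** jacobian (\<lambda>y. fh y \<upsilon> q) (at \<xi>)
     + dfS_dU fS fh U q \<theta> \<xi> \<upsilon> ** jacobian (\<lambda>y. U y \<theta>) (at \<xi>)"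

definition dU_dtheta ::
  "(real^'x \<Rightarrow> real^'w \<Rightarrow> real^'o) \<Rightarrow> real^'w \<Rightarrow> real^'x \<Rightarrow> real^'w^'o" where
  "dU_dtheta U \<theta> \<xi> = jacobian (\<lambda>\<eta>. U \<xi> \<eta>) (at \<theta>)"

definition dU_dpl ::
  "(real^'x \<Rightarrow> real^'w \<Rightarrow> real^'o) \<Rightarrow> real^'w \<Rightarrow> real^'x \<Rightarrow> real^1^'o" where
  "dU_dpl U \<theta> \<xi> = columnvector (vector_derivative (\<lambda>p::real. U \<xi> (p *\<^sub>R \<theta>)) (at 1))"

definition dU_dpll ::
  "(real^'x \<Rightarrow> real^'w \<Rightarrow> real^'o) \<Rightarrow> real^'j^'w \<Rightarrow> real^'x \<Rightarrow> real^'j^'o" where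
  "dU_dpll U \<Xi> \<xi> = jacobian (\<lambda>p. U \<xi> (\<Xi> *v p)) (at ones)"

text \<open>
  Right-hand side \<open>f\<^sub>x G + (\<partial>f\<^sub>S/\<partial>U) D\<close> of a variational equation along \<open>(x, u)\<close>; the argument
  \<open>D\<close>, a function of the current state, is the derivative of \<open>U\<close> with respect to the
  parameters considered.
\<close>

definition variational_rhs ::
  "(real^'f \<Rightarrow> real^'o \<Rightarrow> real^'x) \<Rightarrow> (real^'x \<Rightarrow> real^'u \<Rightarrow> real^'q \<Rightarrow> real^'f) \<Rightarrow>
   (real^'x \<Rightarrow> real^'w \<Rightarrow> real^'o) \<Rightarrow> real^'q \<Rightarrow> real^'w \<Rightarrow> (real \<Rightarrow> real^'x) \<Rightarrow> (real \<Rightarrow> real^'u) \<Rightarrow>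
   (real^'x \<Rightarrow> real^'k^'o) \<Rightarrow> real \<Rightarrow> real^'k^'x \<Rightarrow> real^'k^'x" where
  "variational_rhs fS fh U q \<theta> x u D t G =
     df_dx fS fh U q \<theta> (x t) (u t) ** G + dfS_dU fS fh U q \<theta> (x t) (u t) ** D (x t)"

end

theory Submission
  imports Defs
begin

text \<open>
  The variational equation is affine in \<open>G\<close> and multiplies \<open>G\<close> and the derivative of the network
  from the left only. By the chain rule, lumping the weights multiplies that derivative from the
  right by \<open>\<Xi>\<close>, so \<open>G\<^sub>c \<Xi>\<close> solves the lumped variational equation and uniqueness applies. The last
  identity follows because every weight belongs to exactly one layer, i.e. \<open>\<Xi>\<^sub>l\<^sub>l \<one> = \<theta>\<close>.
\<close>

text \<open>A bounded linear map is Lipschitz with some constant \<open>K\<close>, so the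
  \<open>d\<close> that \<open>g\<close> provides for \<open>e / K\<close> serves for
  \<open>e\<close>. Caratheodory solutions require absolute continuity, so it has to survive
  multiplication by a fixed matrix.\<close>

lemma absolutely_continuous_on_interval_bounded_linear:
  assumes A: "bounded_linear A" and g: "absolutely_continuous_on_interval a b g"
  shows "absolutely_continuous_on_interval a b (\<lambda>t. A (g t))"
  unfolding absolutely_continuous_on_interval_def
proof (intro allI impI)
  fix e :: real assume "e > 0"
  obtain K where K: "K > 0" "\<And>x. norm (A x) \<le> norm x * K"
    using bounded_linear.pos_bounded[OF A] by blast
  have dist_A: "dist (A v) (A w) \<le> K * dist v w" for v w
    using K(2)[of "v - w"] by (simp add: dist_norm linear_diff[OF bounded_linear.linear[OF A]] mult.commute)
  from \<open>e > 0\<close> \<open>K > 0\<close> have "e / K > 0" by simp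
  with g obtain d where "d > 0" and d: "\<And>I :: (real \<times> real) set.
        finite I \<and> (\<forall>(l, r)\<in>I. a \<le> l \<and> l \<le> r \<and> r \<le> b) \<and>
        pairwise (\<lambda>(l, r) (l', r'). {l<..<r} \<inter> {l'<..<r'} = {}) I \<and>
        (\<Sum>(l, r)\<in>I. r - l) < d
        \<Longrightarrow> (\<Sum>(l, r)\<in>I. dist (g l) (g r)) < e / K"
    unfolding absolutely_continuous_on_interval_def by meson
  show "\<exists>d>0. \<forall>I :: (real \<times> real) set.
        finite I \<and> (\<forall>(l, r)\<in>I. a \<le> l \<and> l \<le> r \<and> r \<le> b) \<and>
        pairwise (\<lambda>(l, r) (l', r'). {l<..<r} \<inter> {l'<..<r'} = {}) I \<and>
        (\<Sum>(l, r)\<in>I. r - l) < d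
        \<longrightarrow> (\<Sum>(l, r)\<in>I. dist (A (g l)) (A (g r))) < e"
  proof (intro exI conjI allI impI)
    fix I :: "(real \<times> real) set"
    assume I: "finite I \<and> (\<forall>(l, r)\<in>I. a \<le> l \<and> l \<le> r \<and> r \<le> b) \<and>
        pairwise (\<lambda>(l, r) (l', r'). {l<..<r} \<inter> {l'<..<r'} = {}) I \<and>
        (\<Sum>(l, r)\<in>I. r - l) < d"
    have "(\<Sum>(l, r)\<in>I. dist (A (g l)) (A (g r))) \<le> (\<Sum>(l, r)\<in>I. K * dist (g l) (g r))"
      by (intro sum_mono) (auto simp: dist_A)
    also have "\<dots> = K * (\<Sum>(l, r)\<in>I. dist (g l) (g r))"
      by (simp add: sum_distrib_left case_prod_unfold)
    also have "\<dots> < e"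
      using d[OF I] \<open>K > 0\<close> by (simp add: field_simps)
    finally show "(\<Sum>(l, r)\<in>I. dist (A (g l)) (A (g r))) < e" .
  qed (fact \<open>d > 0\<close>)
qed

text \<open>\<open>A\<close> commutes with differentiation at every point where \<open>y\<close> has
  the required derivative. That \<open>A\<close> intertwines the two right-hand sides is asked only
  along \<open>y\<close>.\<close>

lemma solves_ivp_bounded_linear:
  assumes A: "bounded_linear A" and y: "solves_ivp tf F y0 y"
    and F': "\<And>t. A (F t (y t)) = F' t (A (y t))"
  shows "solves_ivp tf F' (A y0) (\<lambda>t. A (y t))"
  unfolding solves_ivp_def
proof (intro conjI)
  show "absolutely_continuous_on_interval 0 tf (\<lambda>t. A (y t))"
    using y absolutely_continuous_on_interval_bounded_linear[OF A] by (simp add: solves_ivp_def)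
  have "AE t in lebesgue_on {0..tf}. (y has_vector_derivative F t (y t)) (at t within {0..tf})"
    using y by (simp add: solves_ivp_def)
  then show "AE t in lebesgue_on {0..tf}.
      ((\<lambda>t. A (y t)) has_vector_derivative F' t (A (y t))) (at t within {0..tf})"
    by eventually_elim (metis F' bounded_linear.has_vector_derivative[OF A])
  show "A (y 0) = A y0"
    using y by (simp add: solves_ivp_def)
qed

lemma well_posed_ivp_unique:
  assumes "well_posed_ivp tf F y0" "solves_ivp tf F y0 y" "solves_ivp tf F y0 z" "t \<in> {0..tf}"
  shows "y t = z t"
  using assms unfolding well_posed_ivp_def by blast

lemma C1_imp_differentiable: "C1 f \<Longrightarrow> f differentiable (at x)"
  unfolding C1_def differentiable_def by blast

text \<open>Induction over the layers, for all units \<open>r\<close> at once because a unit reads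
  every unit of the previous layer. The argument of the activation is built by sums and products
  from coordinates of \<open>\<theta>\<close> and earlier outputs.\<close>

lemma layer_out_differentiable:
  fixes N :: "('x::finite, 'o, 'w::finite, 'j) ann"
  assumes "\<And>k. k \<in> {1..J} \<Longrightarrow> C1 (activation N k)" and "k \<le> J"
  shows "(\<lambda>\<theta>. layer_out N x \<theta> k r) differentiable (at \<theta>)"
  using \<open>k \<le> J\<close>
proof (induction k arbitrary: r)
  case 0
  then show ?case by simp
next
  case (Suc k)
  have nth: "(\<lambda>\<theta>::real^'w. \<theta> $ i) differentiable (at \<theta>)" for i
    by (simp add: bounded_linear_imp_differentiable bounded_linear_vec_nth)
  have "(\<lambda>\<theta>. (\<Sum>c<width N k. \<theta> $ weight_coord N (Weight (Suc k) r c) * layer_out N x \<theta> k c)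
        + \<theta> $ weight_coord N (Bias (Suc k) r)) differentiable (at \<theta>)"
    using Suc by (intro differentiable_add differentiable_sum ballI differentiable_mult nth) auto
  moreover have "C1 (activation N (Suc k))"
    using Suc.prems assms(1) by simp
  ultimately show ?case
    using differentiable_chain_at[OF _ C1_imp_differentiable] by (simp add: o_def)
qed

lemma ann_fun_differentiable:
  fixes N :: "('x::finite, 'o::finite, 'w::finite, 'j::finite) ann"
  assumes "\<And>k. k \<in> {1..CARD('j)} \<Longrightarrow> C1 (activation N k)"
  shows "ann_fun N x differentiable (at \<theta>)"
proof -
  have "(\<lambda>\<theta>. ann_fun N x \<theta> $ i) differentiable (at \<theta>)" for i
    using layer_out_differentiable[OF assms order_refl] by (simp add: ann_fun_def)
  then show ?thesis
    \<comment> \<open>Differentiability is checked on inner products with the basis vectors, which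
      here are the coordinates.\<close>
    by (subst differentiable_componentwise_within) (auto simp: Basis_vec_def inner_axis)
qed

text \<open>Existence is surjectivity of the weight numbering. Uniqueness combines its injectivity
  with the fact that every position records its own layer.\<close>

lemma belongs_to_layer_unique:
  fixes N :: "('x::finite, 'o::finite, 'w::finite, 'j::finite) ann"
  assumes "is_ann N"
  shows "\<exists>!j. belongs_to_layer N i j"
proof -
  have layer: "bij_betw (layer_number N) UNIV {1..CARD('j)}"
    and coord: "bij_betw (weight_coord N) (\<Union>k\<in>{1..CARD('j)}. layer_positions N k) UNIV"
    using assms by (auto simp: is_ann_def)
  have inj: "inj_on (weight_coord N) (\<Union>k\<in>{1..CARD('j)}. layer_positions N k)"
    using coord by (rule bij_betw_imp_inj_on)
  have range: "layer_number N j \<in> {1..CARD('j)}" for j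
    using bij_betwE[OF layer] by blast
  have "i \<in> weight_coord N ` (\<Union>k\<in>{1..CARD('j)}. layer_positions N k)"
    using bij_betw_imp_surj_on[OF coord] by simp
  then obtain k pos where k: "k \<in> {1..CARD('j)}" and pos: "pos \<in> layer_positions N k"
    and i: "i = weight_coord N pos"
    by blast
  obtain j where j: "k = layer_number N j"
    using k bij_betw_imp_surj_on[OF layer] by (metis imageE)
  show ?thesis
  proof
    show "belongs_to_layer N i j"
      using pos i j by (auto simp: belongs_to_layer_def)
    fix j' assume "belongs_to_layer N i j'"
    then obtain pos' where pos': "pos' \<in> layer_positions N (layer_number N j')"
      and "i = weight_coord N pos'"
      by (auto simp: belongs_to_layer_def)
    \<comment> \<open>Injectivity holds only on positions of layers 1 to \<open>CARD('j)\<close>;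
      \<open>range\<close> places \<open>pos'\<close> among them.\<close>
    then have "pos' = pos"
      using inj i k pos range[of j'] by (metis UN_I inj_onD)
    then have "layer_number N j' = layer_number N j"
      using pos pos' j by (auto simp: layer_positions_def)
    then show "j' = j"
      using bij_betw_imp_inj_on[OF layer] by (simp add: inj_eq)
  qed
qed

text \<open>Row \<open>i\<close> of the matrix has the single entry \<open>\<theta> $ i\<close>, in
  the column of the layer owning weight \<open>i\<close>, and zeros elsewhere.\<close>

lemma Xi_ll_mult_ones:
  assumes "is_ann N"
  shows "Xi_ll N \<theta> *v ones = \<theta>"
proof (rule vec_eq_iff[THEN iffD2], rule allI)
  fix i
  obtain j where "\<And>j'. belongs_to_layer N i j' \<longleftrightarrow> j' = j"
    using belongs_to_layer_unique[OF assms, of i] by blast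
  then show "(Xi_ll N \<theta> *v ones) $ i = \<theta> $ i"
    by (simp add: matrix_vector_mult_def Xi_ll_def ones_def)
qed

lemma matrix_add_mult_distrib:
  fixes A B :: "'a::semiring_1^'n^'m"
  shows "(A + B) ** C = A ** C + B ** C"
  by (simp add: vec_eq_iff matrix_matrix_mult_def distrib_right sum.distrib)

text \<open>Chain rule along the line \<open>p *\<^sub>R \<theta>\<close>, which at
  \<open>p = 1\<close> passes through \<open>\<theta>\<close> with velocity
  \<open>\<theta>\<close>.\<close>

lemma dU_dpl_eq:
  assumes "U \<xi> differentiable (at \<theta>)"
  shows "dU_dpl U \<theta> \<xi> = dU_dtheta U \<theta> \<xi> ** Xi_l \<theta>"
proof -
  have U: "(U \<xi> has_derivative (*v) (dU_dtheta U \<theta> \<xi>)) (at \<theta>)"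
    using assms by (simp add: dU_dtheta_def jacobian_works)
  have "((\<lambda>p::real. p *\<^sub>R \<theta>) has_vector_derivative \<theta>) (at 1)"
    by (auto intro!: derivative_eq_intros)
  with U have "((\<lambda>p. U \<xi> (p *\<^sub>R \<theta>)) has_vector_derivative dU_dtheta U \<theta> \<xi> *v \<theta>) (at 1)"
    using vector_derivative_diff_chain_within[of "\<lambda>p. p *\<^sub>R \<theta>" \<theta> 1 UNIV "U \<xi>"]
    by (simp add: o_def has_derivative_at_withinI)
  then show ?thesis
    by (simp add: dU_dpl_def Xi_l_def dot_rowvector_columnvector[symmetric] vector_derivative_at)
qed

text \<open>Chain rule for the linear map given by \<open>\<Xi>\<close>. The second hypothesis says
  that the nominal parameters reproduce \<open>\<theta>\<close>, so the Jacobian of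
  \<open>U \<xi>\<close> is taken at the right point.\<close>

lemma dU_dpll_eq:
  assumes "U \<xi> differentiable (at \<theta>)" and "\<Xi> *v ones = \<theta>"
  shows "dU_dpll U \<Xi> \<xi> = dU_dtheta U \<theta> \<xi> ** \<Xi>"
proof -
  have U: "(U \<xi> has_derivative (*v) (dU_dtheta U \<theta> \<xi>)) (at (\<Xi> *v ones))"
    using assms by (simp add: dU_dtheta_def jacobian_works)
  have "((*v) \<Xi> has_derivative (*v) \<Xi>) (at ones)"
    by (simp add: bounded_linear_imp_has_derivative)
  from diff_chain_at[OF this U]
  have "((\<lambda>p. U \<xi> (\<Xi> *v p)) has_derivative (*v) (dU_dtheta U \<theta> \<xi> ** \<Xi>)) (at ones)"
    by (simp add: o_def matrix_vector_mul_assoc)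
  from frechet_derivative_at[OF this, symmetric] show ?thesis
    by (simp add: dU_dpll_def jacobian_def)
qed

lemma variational_rhs_mult:
  assumes "D' (x t) = D (x t) ** M"
  shows "variational_rhs fS fh U q \<theta> x u D t G ** M =
    variational_rhs fS fh U q \<theta> x u D' t (G ** M)"
  by (simp add: variational_rhs_def assms matrix_add_mult_distrib matrix_mul_assoc)

text \<open>Common core of both lumping identities: \<open>H\<close> is the lumped sensitivity,
  \<open>G\<close> the full one, and \<open>M\<close> is \<open>Xi_l \<theta>\<close> or
  \<open>Xi_ll N \<theta>\<close>.\<close>

lemma sensitivity_mult_eq:
  assumes G: "solves_ivp tf (variational_rhs fS fh U q \<theta> x u D) 0 G"
    and H: "solves_ivp tf (variational_rhs fS fh U q \<theta> x u D') 0 H"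
    and wp: "well_posed_ivp tf (variational_rhs fS fh U q \<theta> x u D') 0"
    and D': "\<And>\<xi>. D' \<xi> = D \<xi> ** M" and t: "t \<in> {0..tf}"
  shows "H t = G t ** M"
proof -
  have "linear (\<lambda>G. G ** M)"
    by (intro linearI) (simp_all add: matrix_add_mult_distrib scalar_matrix_assoc)
  then have "bounded_linear (\<lambda>G. G ** M)"
    by (rule linear_conv_bounded_linear[THEN iffD1])
  then have "solves_ivp tf (variational_rhs fS fh U q \<theta> x u D') (0 ** M) (\<lambda>t. G t ** M)"
    using G by (rule solves_ivp_bounded_linear) (rule variational_rhs_mult, rule D')
  then have "solves_ivp tf (variational_rhs fS fh U q \<theta> x u D') 0 (\<lambda>t. G t ** M)"
    by simp
  from well_posed_ivp_unique[OF wp H this t] show ?thesis .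
qed

theorem lemma2:
  fixes N :: "('x::finite, 'o::finite, 'w::finite, 'j::finite) ann"
    and U :: "real^'x \<Rightarrow> real^'w \<Rightarrow> real^'o"
    and fS :: "real^'f::finite \<Rightarrow> real^'o \<Rightarrow> real^'x"
    and fh :: "real^'x \<Rightarrow> real^'u::finite \<Rightarrow> real^'q::finite \<Rightarrow> real^'f"
    and x0 :: "real^'q \<Rightarrow> real^'x"
    and q :: "real^'q" and \<theta> :: "real^'w"
    and x :: "real \<Rightarrow> real^'x" and u :: "real \<Rightarrow> real^'u"
    and G_c :: "real \<Rightarrow> real^'w^'x"
    and G_l :: "real \<Rightarrow> real^1^'x"
    and G_ll :: "real \<Rightarrow> real^'j^'x"
    and tf :: real
  defines "U \<equiv> ann_fun N"
  defines "F_c \<equiv> variational_rhs fS fh U q \<theta> x u (dU_dtheta U \<theta>)"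
    and "F_l \<equiv> variational_rhs fS fh U q \<theta> x u (dU_dpl U \<theta>)"
    and "F_ll \<equiv> variational_rhs fS fh U q \<theta> x u (dU_dpll U (Xi_ll N \<theta>))"
  assumes "0 \<le> tf"
    and "is_ann N"
    and "\<And>k. k \<in> {1..CARD('j)} \<Longrightarrow> C1 (activation N k)"
    and "C1 (\<lambda>(z, v). fS z v)"
    and "C1 (\<lambda>(\<xi>, \<upsilon>, r). fh \<xi> \<upsilon> r)"
    and "C1 x0"
    and "solves_ivp tf (\<lambda>t \<xi>. ude_rhs fS fh U q \<theta> \<xi> (u t)) (x0 q) x"
    and "well_posed_ivp tf F_c 0" and "solves_ivp tf F_c 0 G_c"
    and "well_posed_ivp tf F_l 0" and "solves_ivp tf F_l 0 G_l"
    and "well_posed_ivp tf F_ll 0" and "solves_ivp tf F_ll 0 G_ll"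
  shows "AE t in lebesgue_on {0..tf}.
           G_l t = G_c t ** Xi_l \<theta> \<and>
           G_ll t = G_c t ** Xi_ll N \<theta> \<and>
           G_l t = G_ll t ** columnvector ones"
proof (rule AE_I2)
  \<comment> \<open>Uniqueness in \<open>well_posed_ivp\<close> holds at every point of the
    interval, so the identities are shown for each \<open>t\<close> and not only almost
    everywhere.\<close>
  fix t assume "t \<in> space (lebesgue_on {0..tf})"
  then have t: "t \<in> {0..tf}" by simp
  have diff: "U \<xi> differentiable (at \<theta>)" for \<xi>
    unfolding U_def by (rule ann_fun_differentiable) fact
  have ones: "Xi_ll N \<theta> *v ones = \<theta>"
    using \<open>is_ann N\<close> by (rule Xi_ll_mult_ones)
  have l: "G_l t = G_c t ** Xi_l \<theta>"
    by (rule sensitivity_mult_eq[OF _ _ _ dU_dpl_eq[where U = U, OF diff] t])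
      (use assms in \<open>simp_all only: F_c_def F_l_def\<close>)
  have ll: "G_ll t = G_c t ** Xi_ll N \<theta>"
    by (rule sensitivity_mult_eq[OF _ _ _ dU_dpll_eq[where U = U, OF diff ones] t])
      (use assms in \<open>simp_all only: F_c_def F_ll_def\<close>)
  \<comment> \<open>By associativity the right side is \<open>G_c t\<close> times the column of
    \<open>Xi_ll N \<theta> *v ones\<close>, which is \<open>\<theta>\<close>.\<close>
  have "G_l t = G_ll t ** columnvector ones"
    by (simp add: l ll Xi_l_def ones flip: matrix_mul_assoc dot_rowvector_columnvector
        matrix_vector_mul_assoc)
  with l ll show "G_l t = G_c t ** Xi_l \<theta> \<and> G_ll t = G_c t ** Xi_ll N \<theta> \<and>
      G_l t = G_ll t ** columnvector ones"
    by simp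
qed

end
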